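(* Let $I \subseteq \mathbb{R}$ be a compact interval (of positive length). Let $(k_j)_{j\ge 0}$ be a special base sequence and let $M=(M_j)_{j\ge 0}$ be a weight sequence such that $m_{k_{j+1}}/m_{k_j}$ is bounded in $j$, where $m_j := M_j^{1/j}$. Then: (a) $\mathcal{B}^{\{M\}}_{L^\infty,(k_j)}(I)= \mathcal{B}^{\{M\}}_{L^\infty}(I)$ provided that $j/m_j$ is bounded. (b) $\mathcal{B}^{(M)}_{L^\infty,(k_j)}(I)= \mathcal{B}^{(M)}_{L^\infty}(I)$ provided that $j/m_j \to 0$ as $j \to\infty$.
   Context: A base sequence is a strictly increasing infinite sequence $0 = k_0 < k_1 < k_2 < \cdots$ of integers; it is called special if $k_{j+1}/k_j$, $j \ge 1$, is bounded. A weight sequence is a positive sequence $M=(M_k)_{k\ge 0}$ with $M_0=1\le M_1 \le \mu_2 \le \mu_3 \le \cdots$, where $\mu_k:= M_k/M_{k-1}$. We put $m_k:= M_k^{1/k}$ for $k\ge 1$ and $m_0:=1$ (so that $(\rho m_k)^k=\rho^k M_k$ for all $k \ge 0$). For a compact interval $I\subseteq\mathbb{R}$: $\mathcal{B}^{\{M\}}_{L^\infty}(I)$ is the set of $f \in C^\infty(I)$ such that there exist $C,\rho>0$ with $\|f^{(\ell)}\|_{L^\infty(I)} \le C(\rho m_{\ell})^\ell$ for all integers $\ell\ge 0$. $\mathcal{B}^{(M)}_{L^\infty}(I)$ is the set of $f \in C^\infty(I)$ such that for every $\rho>0$ there exists $C>0$ with $\|f^{(\ell)}\|_{L^\infty(I)}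 \le C(\rho m_{\ell})^\ell$ for all $\ell\ge 0$. $\mathcal{B}^{\{M\}}_{L^\infty,(k_j)}(I)$ and $\mathcal{B}^{(M)}_{L^\infty,(k_j)}(I)$ are the sets of $f\in C^\infty(I)$ defined by the same conditions, but with the estimates required only for the orders $\ell \in \{k_j : j \ge 0\}$. *)

theory Defs
  imports "HOL-Analysis.Analysis" "HOL-Probability.Essential_Supremum"
begin

definition base_sequence :: "(nat \<Rightarrow> nat) \<Rightarrow> bool" where
  "base_sequence k \<longleftrightarrow> k 0 = 0 \<and> strict_mono k"

definition special_base_sequence :: "(nat \<Rightarrow> nat) \<Rightarrow> bool" where
  "special_base_sequence k \<longleftrightarrow>
     base_sequence k \<and> bounded ((\<lambda>j. real (k (Suc j)) / real (k j)) ` {1..})"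

text \<open>Used only for \<open>k \<ge> 1\<close>; at \<open>k = 0\<close> the subtraction truncates.\<close>

definition weight_quotient :: "(nat \<Rightarrow> real) \<Rightarrow> nat \<Rightarrow> real" where
  "weight_quotient M k = M k / M (k - 1)"

definition weight_sequence :: "(nat \<Rightarrow> real) \<Rightarrow> bool" where
  "weight_sequence M \<longleftrightarrow>
     (\<forall>k. M k > 0) \<and> M 0 = 1 \<and> 1 \<le> M 1 \<and> M 1 \<le> weight_quotient M 2 \<and>
     (\<forall>k\<ge>2. weight_quotient M k \<le> weight_quotient M (Suc k))"

text \<open>The case distinction is needed because \<open>root 0 x = 0\<close>.\<close>

definition weight_root :: "(nat \<Rightarrow> real) \<Rightarrow> nat \<Rightarrow> real" where
  "weight_root M k = (if k = 0 then 1 else root k (M k))"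

text \<open>
  Functions on an interval \<open>I\<close> are represented by total functions whose values outside \<open>I\<close>
  are irrelevant. All derivatives are taken within \<open>I\<close>, hence one-sided at the endpoints;
  they are unique when \<open>I\<close> has positive length. The scalar class \<open>real_normed_field\<close>
  covers both real- and complex-valued functions.
\<close>

primrec nth_deriv_within ::
  "real set \<Rightarrow> nat \<Rightarrow> (real \<Rightarrow> 'a::real_normed_field) \<Rightarrow> real \<Rightarrow> 'a" where
  "nth_deriv_within I 0 f = f"
| "nth_deriv_within I (Suc n) f =
     (\<lambda>x. vector_derivative (nth_deriv_within I n f) (at x within I))"

text \<open>Continuity of every derivative follows from its differentiability.\<close>

definition C_infinity_on :: "real set \<Rightarrow> (real \<Rightarrow> 'a::real_normed_field) set" where
  "C_infinity_on I = {f. \<forall>n. nth_deriv_within I n f differentiable_on I}"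

definition Linf_norm :: "real set \<Rightarrow> (real \<Rightarrow> 'a::real_normed_field) \<Rightarrow> ereal" where
  "Linf_norm I f = esssup (lebesgue_on I) (\<lambda>x. ereal (norm (f x)))"

definition roumieu_class ::
  "(nat \<Rightarrow> real) \<Rightarrow> real set \<Rightarrow> (real \<Rightarrow> 'a::real_normed_field) set" where
  "roumieu_class M I = {f \<in> C_infinity_on I. \<exists>C>0. \<exists>\<rho>>0. \<forall>l.
     Linf_norm I (nth_deriv_within I l f) \<le> ereal (C * (\<rho> * weight_root M l) ^ l)}"

definition beurling_class ::
  "(nat \<Rightarrow> real) \<Rightarrow> real set \<Rightarrow> (real \<Rightarrow> 'a::real_normed_field) set" where
  "beurling_class M I = {f \<in> C_infinity_on I. \<forall>\<rho>>0. \<exists>C>0. \<forall>l.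
     Linf_norm I (nth_deriv_within I l f) \<le> ereal (C * (\<rho> * weight_root M l) ^ l)}"

definition roumieu_class_base ::
  "(nat \<Rightarrow> real) \<Rightarrow> (nat \<Rightarrow> nat) \<Rightarrow> real set \<Rightarrow> (real \<Rightarrow> 'a::real_normed_field) set" where
  "roumieu_class_base M k I = {f \<in> C_infinity_on I. \<exists>C>0. \<exists>\<rho>>0. \<forall>l\<in>range k.
     Linf_norm I (nth_deriv_within I l f) \<le> ereal (C * (\<rho> * weight_root M l) ^ l)}"

definition beurling_class_base ::
  "(nat \<Rightarrow> real) \<Rightarrow> (nat \<Rightarrow> nat) \<Rightarrow> real set \<Rightarrow> (real \<Rightarrow> 'a::real_normed_field) set" where
  "beurling_class_base M k I = {f \<in> C_infinity_on I. \<forall>\<rho>>0. \<exists>C>0. \<forall>l\<in>range k.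
     Linf_norm I (nth_deriv_within I l f) \<le> ereal (C * (\<rho> * weight_root M l) ^ l)}"

end

theory Submission
  imports Defs
begin

text \<open>
  Only the inclusions of the base classes in the full classes need an argument, and there the
  task is to bound a derivative of order \<open>l\<close> between two consecutive base orders
  \<open>k j \<le> l < k (Suc j) = n\<close>. The key is an interpolation inequality in the style of Gorny and
  Cartan, lemma \<open>intermediate_derivative_bound\<close>: if \<open>\<bar>f\<bar> \<le> C\<close> and
  \<open>\<bar>f\<^sup>(\<^sup>n\<^sup>)\<bar> \<le> C r\<^sup>n\<close> on an interval of length at least \<open>2n / r\<close>, then
  \<open>\<bar>f\<^sup>(\<^sup>l\<^sup>)\<bar> \<le> C 288\<^sup>n r\<^sup>l\<close> for all \<open>l < n\<close>. What matters is that the constant is only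
  exponential in \<open>n\<close>: iterating the inequality for first and second derivatives would cost
  a factor exponential in \<open>n\<^sup>2\<close>.

  Given the inequality, take \<open>r = \<rho> m\<^sub>n\<close>. Since the base sequence is special, \<open>n \<le> B l\<close>,
  so \<open>288\<^sup>n\<close> is absorbed into an \<open>l\<close>-th power; since \<open>m\<close> is increasing and its ratios along
  the base sequence are bounded, \<open>m\<^sub>n \<le> R m\<^sub>l\<close>. The result is a bound \<open>C (A \<rho> m\<^sub>l)\<^sup>l\<close> with \<open>A\<close>
  depending only on \<open>k\<close> and \<open>M\<close>. The length condition \<open>2n \<le> \<rho> m\<^sub>n (b - a)\<close> is where \<open>j / m\<^sub>j\<close>
  enters: if that quotient is bounded the condition holds once \<open>\<rho>\<close> is enlarged, which the
  Roumieu class permits; if it tends to \<open>0\<close> the condition holds for every \<open>\<rho>\<close> and all large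
  \<open>n\<close>, as the Beurling class requires. The finitely many remaining orders only change \<open>C\<close>.

  For the inequality itself, fix a point \<open>x\<close> and walk from it into the interval over a length
  \<open>d = n / r\<close>. By Taylor's theorem \<open>f\<close> differs from a polynomial of degree less than \<open>n\<close> by at
  most \<open>C r\<^sup>n d\<^sup>n / n! \<le> C 3\<^sup>n\<close>, so that polynomial is at most \<open>C 4\<^sup>n\<close> on the segment. Its
  coefficients are the \<open>f\<^sup>(\<^sup>l\<^sup>)(x) / l!\<close>, and the coefficients of a polynomial of degree \<open>N\<close> on
  a unit interval are at most \<open>72\<^sup>N\<close> times its supremum
  (lemma \<open>polynomial_coefficient_bound\<close>).
\<close>

section \<open>Coefficients of a polynomial bounded on the unit interval\<close>

lemma power_self_le_fact: "real n ^ n \<le> 3 ^ n * fact n"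
proof (induction n)
  case 0
  then show ?case by simp
next
  case (Suc n)
  show ?case
  proof (cases "n = 0")
    case False
    have "(1 + 1 / real n) ^ n \<le> 3"
      using exp_ge_one_plus_x_over_n_power_n[of n 1] False exp_le by simp
    moreover have "real (Suc n) ^ n = (1 + 1 / real n) ^ n * real n ^ n"
      using False by (simp flip: power_mult_distrib add: field_simps)
    ultimately have "real (Suc n) ^ n \<le> 3 * real n ^ n"
      by (simp add: mult_right_mono)
    also have "\<dots> \<le> 3 * (3 ^ n * fact n)"
      using Suc by simp
    finally have "real (Suc n) * real (Suc n) ^ n \<le> real (Suc n) * (3 * (3 ^ n * fact n))"
      by (intro mult_left_mono) auto
    then show ?thesis by (simp add: mult_ac)
  qed simp
qed

text \<open>
  Replacing \<open>P t\<close> by \<open>P t - q\<^sup>j P (t / q)\<close> multiplies the coefficient of degree \<open>i\<close> by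
  \<open>1 - q\<^sup>j / q\<^sup>i\<close>. The choice \<open>q = 1 + 1/N\<close> keeps \<open>q\<^sup>N \<le> e\<close>, and then by Bernoulli's inequality
  this factor is comparable to \<open>(i - j) / N\<close>, as for equidistant nodes in Lagrange
  interpolation. A fixed ratio such as \<open>q = 2\<close> would lead to constants exponential in \<open>N\<^sup>2\<close>.
\<close>

lemma dilation_factor_lower_bound:
  fixes N i j :: nat
  assumes "i \<le> N" "j \<le> N" "i \<noteq> j"
  defines "q \<equiv> 1 + 1 / real N"
  shows "\<bar>real i - real j\<bar> / (3 * real N) \<le> \<bar>1 - q ^ j / q ^ i\<bar>"
proof -
  have N: "N > 0" using assms by auto
  have lam: "q \<ge> 1" by (simp add: q_def)
  have bern: "1 + real d / real N \<le> q ^ d" for d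
    using Bernoulli_inequality[of "1 / real N" d] by (simp add: q_def order_trans[of "-1" 0])
  show ?thesis
  proof (cases "i < j")
    case True
    then have "q ^ j / q ^ i = q ^ (j - i)"
      using lam by (simp add: power_diff)
    moreover have "real (j - i) / real N \<le> q ^ (j - i) - 1"
      using bern[of "j - i"] by simp
    moreover have "\<bar>real i - real j\<bar> / (3 * real N) \<le> real (j - i) / real N"
      using True N by (simp add: field_simps of_nat_diff)
    ultimately show ?thesis by linarith
  next
    case False
    define p where "p = q ^ (i - j)"
    have "q ^ i = q ^ j * p"
      using False assms by (simp add: p_def flip: power_add)
    then have eq: "1 - q ^ j / q ^ i = (p - 1) / p"
      using lam by (simp add: p_def field_simps)
    have p1: "p \<ge> 1" using lam by (simp add: p_def one_le_power)
    have "p \<le> q ^ N"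
      unfolding p_def using lam assms by (intro power_increasing) auto
    also have "\<dots> \<le> 3"
      using exp_ge_one_plus_x_over_n_power_n[of N 1] N exp_le by (simp add: q_def)
    finally have p3: "p \<le> 3" .
    have d: "\<bar>real i - real j\<bar> = real (i - j)" using False assms by (simp add: of_nat_diff)
    have "real (i - j) / real N \<le> p - 1"
      using bern[of "i - j"] by (simp add: p_def)
    then have "(real (i - j) / real N) / 3 \<le> (p - 1) / p"
      using p1 p3 by (intro frac_le) auto
    then show ?thesis
      using p1 by (simp add: eq d field_simps)
  qed
qed

text \<open>
  The monomials of degrees \<open>j \<in> J\<close> are eliminated one after the other by the operators
  \<open>P t \<mapsto> P t - q\<^sup>j P (t / q)\<close>, until only the monomial of degree \<open>i\<close> is left. Each operator
  enlarges the supremum on \<open>[0, 1]\<close> by a factor of at most \<open>1 + q\<^sup>j \<le> 4\<close> and multiplies the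
  coefficient of degree \<open>i\<close> by a factor of modulus at least \<open>\<bar>i - j\<bar> / (3 N)\<close>; the quotient
  of the two factors appears in the product.
\<close>

lemma coefficient_bound_by_dilations:
  fixes c :: "nat \<Rightarrow> 'a::real_normed_vector"
  assumes "finite J" "J \<subseteq> {..N}" "i \<le> N" "i \<notin> J"
    and "\<And>t. t \<in> {0..1} \<Longrightarrow> norm (\<Sum>m\<in>insert i J. t ^ m *\<^sub>R c m) \<le> S"
  shows "norm (c i) \<le> S * (\<Prod>j\<in>J. 12 * real N / \<bar>real i - real j\<bar>)"
  using assms
proof (induction J arbitrary: c S rule: finite_induct)
  case empty
  from empty.prems(4)[of 1] show ?case by simp
next
  case (insert j J)
  define q where "q = 1 + 1 / real N"
  \<comment> \<open>\<open>c'\<close> are the coefficients after one elimination step; \<open>c' j\<close> vanishes.\<close>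
  define P where "P = (\<lambda>t. \<Sum>m\<in>insert i (insert j J). t ^ m *\<^sub>R c m)"
  define c' where "c' = (\<lambda>m. (1 - q ^ j / q ^ m) *\<^sub>R c m)"
  have ij: "i \<noteq> j" "j \<le> N" "i \<notin> J" "J \<subseteq> {..N}" using insert.prems by auto
  then have N: "N > 0" using insert.prems by auto
  have lam: "q \<ge> 1" by (simp add: q_def)
  have lamj: "q ^ j \<le> 3"
  proof -
    have "q ^ j \<le> q ^ N" using lam ij by (intro power_increasing) auto
    also have "\<dots> \<le> 3"
      using exp_ge_one_plus_x_over_n_power_n[of N 1] N exp_le by (simp add: q_def)
    finally show ?thesis .
  qed
  have bP: "norm (P t) \<le> S" if "t \<in> {0..1}" for t
    using insert.prems(4)[OF that] by (simp add: P_def)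
  have S0: "S \<ge> 0" by (rule order_trans[OF norm_ge_zero bP[of 0]]) simp
  have "norm (c' i) \<le> 4 * S * (\<Prod>j\<in>J. 12 * real N / \<bar>real i - real j\<bar>)"
  proof (rule insert.IH)
    fix t :: real assume t: "t \<in> {0..1}"
    have t': "t / q \<in> {0..1}" using t lam by (simp add: divide_le_eq)
    have "(\<Sum>m\<in>insert i J. t ^ m *\<^sub>R c' m) = (\<Sum>m\<in>insert i (insert j J). t ^ m *\<^sub>R c' m)"
      using lam insert.hyps by (intro sum.mono_neutral_left) (auto simp: c'_def)
    also have "\<dots> = (\<Sum>m\<in>insert i (insert j J). t ^ m *\<^sub>R c m - q ^ j *\<^sub>R ((t / q) ^ m *\<^sub>R c m))"
      by (intro sum.cong refl)
         (simp add: c'_def power_divide algebra_simps)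
    also have "\<dots> = P t - q ^ j *\<^sub>R P (t / q)"
      by (simp only: P_def sum_subtractf scaleR_sum_right)
    finally have "norm (\<Sum>m\<in>insert i J. t ^ m *\<^sub>R c' m) \<le> norm (P t) + q ^ j * norm (P (t / q))"
      using lam by (simp add: norm_triangle_ineq4[THEN order_trans])
    also have "\<dots> \<le> S + 3 * S"
      using bP[OF t] bP[OF t'] lamj S0 by (intro add_mono mult_mono) auto
    finally show "norm (\<Sum>m\<in>insert i J. t ^ m *\<^sub>R c' m) \<le> 4 * S" by simp
  qed (use ij insert.prems in auto)
  moreover have "\<bar>real i - real j\<bar> / (3 * real N) * norm (c i) \<le> norm (c' i)"
    using mult_right_mono[OF dilation_factor_lower_bound[of i N j] norm_ge_zero[of "c i"]]
      ij insert.prems(2)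
    by (simp add: c'_def q_def)
  ultimately have "\<bar>real i - real j\<bar> / (3 * real N) * norm (c i)
      \<le> 4 * S * (\<Prod>j\<in>J. 12 * real N / \<bar>real i - real j\<bar>)" by linarith
  then show ?case
    using ij N insert.hyps by (simp add: field_simps)
qed

text \<open>
  Eliminating all other degrees costs \<open>(12 N)\<^sup>N / (i! (N - i)!)\<close>. This is
  \<open>12\<^sup>N\<close> times \<open>N choose i\<close>, at most \<open>2\<^sup>N\<close>, times \<open>N\<^sup>N / N!\<close>, at most \<open>3\<^sup>N\<close>.
\<close>

lemma polynomial_coefficient_bound:
  fixes c :: "nat \<Rightarrow> 'a::real_normed_vector"
  assumes "i \<le> N"
    and bd: "\<And>t. t \<in> {0..1} \<Longrightarrow> norm (\<Sum>m\<le>N. t ^ m *\<^sub>R c m) \<le> S"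
  shows "norm (c i) \<le> 72 ^ N * S"
proof -
  have S0: "S \<ge> 0" by (rule order_trans[OF norm_ge_zero bd[of 0]]) simp
  have split: "{..N} - {i} = {..<i} \<union> {i<..N}" using assms by auto
  have low: "(\<Prod>j<i. \<bar>real i - real j\<bar>) = fact i"
  proof -
    have "(\<Prod>j<i. \<bar>real i - real j\<bar>) = (\<Prod>m\<in>{1..i}. real m)"
      by (rule prod.reindex_bij_witness[of _ "\<lambda>m. i - m" "\<lambda>j. i - j"]) auto
    then show ?thesis by (simp add: fact_prod)
  qed
  have up: "(\<Prod>j\<in>{i<..N}. \<bar>real i - real j\<bar>) = fact (N - i)"
  proof -
    have "(\<Prod>j\<in>{i<..N}. \<bar>real i - real j\<bar>) = (\<Prod>m\<in>{1..N-i}. real m)"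
      by (rule prod.reindex_bij_witness[of _ "\<lambda>m. m + i" "\<lambda>j. j - i"]) auto
    then show ?thesis by (simp add: fact_prod)
  qed
  have den: "(\<Prod>j\<in>{..N}-{i}. \<bar>real i - real j\<bar>) = fact i * fact (N - i)"
    unfolding split by (subst prod.union_disjoint) (auto simp: low up simp del: abs_of_nonneg abs_of_nonpos)
  have "(\<Prod>j\<in>{..N}-{i}. 12 * real N / \<bar>real i - real j\<bar>)
      = (12 * real N) ^ N / (fact i * fact (N - i))"
    using assms by (simp add: prod_dividef den)
  also have "\<dots> = 12 ^ N * (real (N choose i) * (real N ^ N / fact N))"
    using assms by (simp add: binomial_fact power_mult_distrib)
  also have "\<dots> \<le> 12 ^ N * (2 ^ N * 3 ^ N)"
  proof -
    have "real (N choose i) \<le> 2 ^ N"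
      by (metis binomial_le_pow2 of_nat_le_iff of_nat_numeral of_nat_power)
    moreover have "real N ^ N / fact N \<le> 3 ^ N"
      using power_self_le_fact[of N] by (simp add: divide_le_eq)
    ultimately show ?thesis by (intro mult_left_mono mult_mono) auto
  qed
  also have "\<dots> = (72::real) ^ N" by (simp flip: power_mult_distrib)
  finally have weights: "(\<Prod>j\<in>{..N}-{i}. 12 * real N / \<bar>real i - real j\<bar>) \<le> 72 ^ N" .
  have "norm (c i) \<le> S * (\<Prod>j\<in>{..N}-{i}. 12 * real N / \<bar>real i - real j\<bar>)"
    using assms by (intro coefficient_bound_by_dilations[of _ N]) (auto simp: insert_absorb)
  also have "\<dots> \<le> S * 72 ^ N"
    by (rule mult_left_mono[OF weights S0])
  finally show ?thesis by (simp add: mult.commute)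
qed

section \<open>Derivatives of intermediate order\<close>

text \<open>
  The \<open>D i\<close> are the successive derivatives of \<open>D 0\<close>. The induction applies the hypothesis to
  \<open>D 1\<close> and integrates by means of the mean value inequality for vector-valued functions.
\<close>

lemma taylor_remainder_bound:
  fixes D :: "nat \<Rightarrow> real \<Rightarrow> 'a::real_normed_vector"
  assumes D: "\<And>i t. i < n \<Longrightarrow> t \<in> {0..d} \<Longrightarrow>
      (D i has_vector_derivative D (Suc i) t) (at t within {0..d})"
    and F: "\<And>t. t \<in> {0..d} \<Longrightarrow> norm (D n t) \<le> F"
    and t: "t \<in> {0..d}"
  shows "norm (D 0 t - (\<Sum>i<n. (t ^ i / fact i) *\<^sub>R D i 0)) \<le> F * t ^ n / fact n"
  using D F t
proof (induction n arbitrary: D t)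
  case 0
  then show ?case by simp
next
  case (Suc n)
  define R where "R = (\<lambda>D n t. D 0 t - (\<Sum>i<n. (t ^ i / fact i) *\<^sub>R D i (0::real)) :: 'a)"
  define D1 where "D1 = (\<lambda>i. D (Suc i))"
  have IH: "norm (R D1 n s) \<le> F * s ^ n / fact n" if "s \<in> {0..d}" for s
    unfolding R_def using that Suc.prems by (intro Suc.IH) (auto simp: D1_def)
  have mono: "((\<lambda>t. t ^ Suc i / fact (Suc i)) has_vector_derivative s ^ i / fact i) (at s within A)"
    for i s A
    unfolding has_real_derivative_iff_has_vector_derivative[symmetric]
    by (rule derivative_eq_intros refl | simp)+
  have R_eq: "R D (Suc n) = (\<lambda>t. D 0 t - (D 0 0 + (\<Sum>i<n. (t ^ Suc i / fact (Suc i)) *\<^sub>R D1 i 0)))"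
    by (rule ext) (simp add: R_def D1_def sum.lessThan_Suc_shift del: sum.lessThan_Suc)
  have R': "(R D (Suc n) has_vector_derivative R D1 n s) (at s within {0..d})" if "s \<in> {0..d}" for s
  proof -
    have "((\<lambda>t. (t ^ Suc i / fact (Suc i)) *\<^sub>R D1 i 0) has_vector_derivative
        (s ^ i / fact i) *\<^sub>R D1 i 0) (at s within {0..d})" for i
      using mono[of i s "{0..d}"]
      by (intro has_vector_derivative_scaleR[THEN has_vector_derivative_eq_rhs])
         (auto simp: has_real_derivative_iff_has_vector_derivative)
    then have "((\<lambda>t. \<Sum>i<n. (t ^ Suc i / fact (Suc i)) *\<^sub>R D1 i 0) has_vector_derivative
        (\<Sum>i<n. (s ^ i / fact i) *\<^sub>R D1 i 0)) (at s within {0..d})"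
      by (intro has_vector_derivative_sum)
    moreover have "(D 0 has_vector_derivative D1 0 s) (at s within {0..d})"
      using Suc.prems(1)[of 0 s] that by (simp add: D1_def)
    ultimately have "((\<lambda>t. D 0 t - (D 0 0 + (\<Sum>i<n. (t ^ Suc i / fact (Suc i)) *\<^sub>R D1 i 0)))
        has_vector_derivative (D1 0 s - (0 + (\<Sum>i<n. (s ^ i / fact i) *\<^sub>R D1 i 0)))) (at s within {0..d})"
      by (intro has_vector_derivative_diff has_vector_derivative_add has_vector_derivative_const)
    then show ?thesis unfolding R_eq by (simp add: R_def)
  qed
  define \<phi> where "\<phi> = (\<lambda>t. F * (t ^ Suc n / fact (Suc n)))"
  have phi': "(\<phi> has_vector_derivative F * (s ^ n / fact n)) (at s within A)" for s A
    unfolding \<phi>_def using mono[of n s A] by (rule has_vector_derivative_mult_right)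
  have R0: "R D (Suc n) 0 = 0" by (simp add: R_eq)
  show ?case
  proof (cases "t = 0")
    case True
    then show ?thesis using R0 by (simp add: R_def)
  next
    case False
    then have t0: "0 < t" "t \<le> d" using Suc.prems by auto
    have "norm (R D (Suc n) t - R D (Suc n) 0) \<le> \<phi> t - \<phi> 0"
    proof (rule differentiable_bound_general[OF t0(1)])
      show "continuous_on {0..t} (R D (Suc n))"
        by (rule continuous_on_subset[of "{0..d}"])
           (use t0 R'[THEN has_vector_derivative_continuous] in
              \<open>auto simp: continuous_on_eq_continuous_within\<close>)
      show "continuous_on {0..t} \<phi>"
        unfolding \<phi>_def by (intro continuous_intros) auto
      fix s assume s: "0 < s" "s < t"
      have "at s within {0..d} = at s"
        using s t0 by (intro at_within_interior) auto
      then show "(R D (Suc n) has_vector_derivative R D1 n s) (at s)"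
        using R'[of s] s t0 by auto
      show "(\<phi> has_vector_derivative F * (s ^ n / fact n)) (at s)" by (rule phi')
      show "norm (R D1 n s) \<le> F * (s ^ n / fact n)" using IH[of s] s t0 by simp
    qed
    then show ?thesis by (simp only: R0) (simp add: R_def \<phi>_def)
  qed
qed

text \<open>
  The Taylor polynomial at \<open>0\<close>, rescaled to \<open>[0, 1]\<close>, has the coefficients
  \<open>d\<^sup>i D i 0 / i!\<close>, and it is bounded by the supremum of \<open>D 0\<close> plus the Taylor remainder.
\<close>

lemma intermediate_derivative_bound_endpoint:
  fixes D :: "nat \<Rightarrow> real \<Rightarrow> 'a::real_normed_vector"
  assumes D: "\<And>i t. i < n \<Longrightarrow> t \<in> {0..d} \<Longrightarrow>
      (D i has_vector_derivative D (Suc i) t) (at t within {0..d})"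
    and d: "d > 0"
    and F0: "\<And>t. t \<in> {0..d} \<Longrightarrow> norm (D 0 t) \<le> F0"
    and Fn: "\<And>t. t \<in> {0..d} \<Longrightarrow> norm (D n t) \<le> Fn"
    and l: "l < n"
  shows "norm (D l 0) * d ^ l \<le> fact l * (72 ^ n * (F0 + Fn * d ^ n / fact n))"
proof -
  define S where "S = F0 + Fn * d ^ n / fact n"
  define c where "c = (\<lambda>i. (d ^ i / fact i) *\<^sub>R D i 0)"
  have Fn0: "Fn \<ge> 0" using d by (intro order_trans[OF norm_ge_zero Fn[of 0]]) simp
  have F00: "F0 \<ge> 0" using d by (intro order_trans[OF norm_ge_zero F0[of 0]]) simp
  have S0: "S \<ge> 0" using Fn0 F00 d by (simp add: S_def)
  have "norm (c l) \<le> 72 ^ (n - 1) * S"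
  proof (rule polynomial_coefficient_bound)
    show "l \<le> n - 1" using l by simp
    fix t :: real assume t: "t \<in> {0..1}"
    have td: "t * d \<in> {0..d}" using t d by (auto simp: mult_left_le_one_le)
    define T where "T = (\<Sum>i<n. ((t * d) ^ i / fact i) *\<^sub>R D i 0)"
    have "{..n - 1} = {..<n}" using l by auto
    then have "(\<Sum>m\<le>n - 1. t ^ m *\<^sub>R c m) = T"
      by (simp add: T_def c_def power_mult_distrib)
    then have "norm (\<Sum>m\<le>n - 1. t ^ m *\<^sub>R c m) = norm T" by simp
    also have "\<dots> \<le> norm (D 0 (t * d)) + norm (D 0 (t * d) - T)"
      by (metis add.commute norm_minus_commute norm_triangle_sub)
    also have "\<dots> \<le> F0 + Fn * (t * d) ^ n / fact n"
      using taylor_remainder_bound[OF D Fn td] F0[OF td] by (simp add: T_def)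
    also have "\<dots> \<le> S"
      unfolding S_def using td Fn0
      by (intro add_left_mono divide_right_mono mult_left_mono power_mono) auto
    finally show "norm (\<Sum>m\<le>n - 1. t ^ m *\<^sub>R c m) \<le> S" .
  qed
  also have "\<dots> \<le> 72 ^ n * S"
    using S0 by (intro mult_right_mono power_increasing) auto
  finally show ?thesis using d by (simp add: c_def S_def field_simps)
qed

lemma nth_deriv_within_has_vector_derivative:
  assumes "f \<in> C_infinity_on I" "x \<in> I"
  shows "(nth_deriv_within I i f has_vector_derivative nth_deriv_within I (Suc i) f x) (at x within I)"
proof -
  have "nth_deriv_within I i f differentiable (at x within I)"
    using assms by (simp add: C_infinity_on_def differentiable_on_def)
  then show ?thesis
    by (simp only: nth_deriv_within.simps vector_derivative_works)
qed

lemma nth_deriv_within_continuous_on: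
  assumes "f \<in> C_infinity_on I"
  shows "continuous_on I (nth_deriv_within I i f)"
  using assms by (auto simp: C_infinity_on_def intro: differentiable_imp_continuous_on)

text \<open>
  The step length \<open>d = n / r\<close> balances the two terms in the endpoint bound, since
  \<open>r\<^sup>n d\<^sup>n / n! = n\<^sup>n / n!\<close> is only exponential in \<open>n\<close>. It is at most half the length of the
  interval, so from every point there is room for such a step to the right or to the left.
\<close>

lemma intermediate_derivative_bound:
  fixes f :: "real \<Rightarrow> 'a::real_normed_field"
  assumes f: "f \<in> C_infinity_on {a..b}"
    and l: "l < n"
    and r: "r > 0" "2 * real n \<le> r * (b - a)"
    and C: "\<And>y. y \<in> {a..b} \<Longrightarrow> norm (f y) \<le> C"
    and Cn: "\<And>y. y \<in> {a..b} \<Longrightarrow> norm (nth_deriv_within {a..b} n f y) \<le> C * r ^ n"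
    and x: "x \<in> {a..b}"
  shows "norm (nth_deriv_within {a..b} l f x) \<le> C * 288 ^ n * r ^ l"
proof -
  define d where "d = real n / r"
  have n0: "n > 0" using l by simp
  have d: "d > 0" "2 * d \<le> b - a" using n0 r by (auto simp: d_def field_simps)
  have C0: "C \<ge> 0" using C[OF x] norm_ge_zero order_trans by blast
  obtain s :: real where s: "\<bar>s\<bar> = 1" "\<And>t. t \<in> {0..d} \<Longrightarrow> x + s * t \<in> {a..b}"
  proof (cases "x + d \<le> b")
    case True
    then show ?thesis using x that[of 1] by auto
  next
    case False
    then show ?thesis using x d that[of "-1"] by auto
  qed
  \<comment> \<open>The derivatives of \<open>f\<close> along the segment, in the direction \<open>s = \<plusminus>1\<close>.\<close>
  define D where "D = (\<lambda>i t. s ^ i *\<^sub>R nth_deriv_within {a..b} i f (x + s * t))"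
  have nD: "norm (D i t) = norm (nth_deriv_within {a..b} i f (x + s * t))" for i t
    using s by (simp add: D_def power_abs)
  have "norm (D l 0) * d ^ l \<le> fact l * (72 ^ n * (C + C * r ^ n * d ^ n / fact n))"
  proof (rule intermediate_derivative_bound_endpoint[OF _ d(1) _ _ l])
    fix t assume t: "t \<in> {0..d}"
    show "norm (D 0 t) \<le> C" "norm (D n t) \<le> C * r ^ n"
      using C Cn s(2)[OF t] by (auto simp: nD)
  next
    fix i t assume t: "t \<in> {0..d}"
    have "((\<lambda>t. x + s * t) has_vector_derivative s) (at t within {0..d})"
      unfolding has_real_derivative_iff_has_vector_derivative[symmetric]
      by (auto intro!: derivative_eq_intros)
    moreover have "(nth_deriv_within {a..b} i f has_vector_derivative
        nth_deriv_within {a..b} (Suc i) f (x + s * t)) (at (x + s * t) within (\<lambda>t. x + s * t) ` {0..d})"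
      by (rule has_vector_derivative_within_subset[OF nth_deriv_within_has_vector_derivative[OF f]])
         (use s t in auto)
    ultimately have "((nth_deriv_within {a..b} i f \<circ> (\<lambda>t. x + s * t)) has_vector_derivative
        s *\<^sub>R nth_deriv_within {a..b} (Suc i) f (x + s * t)) (at t within {0..d})"
      by (rule vector_diff_chain_within)
    then have "((\<lambda>t. s ^ i *\<^sub>R (nth_deriv_within {a..b} i f \<circ> (\<lambda>t. x + s * t)) t) has_vector_derivative
        s ^ i *\<^sub>R (s *\<^sub>R nth_deriv_within {a..b} (Suc i) f (x + s * t))) (at t within {0..d})"
      by (intro bounded_linear.has_vector_derivative[OF bounded_linear_scaleR_right])
    then show "(D i has_vector_derivative D (Suc i) t) (at t within {0..d})"
      by (simp add: D_def o_def mult.commute del: nth_deriv_within.simps)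
  qed
  also have "C + C * r ^ n * d ^ n / fact n = C * (1 + real n ^ n / fact n)"
    using r by (simp add: d_def power_divide algebra_simps)
  also have "\<dots> \<le> C * 4 ^ n"
  proof (rule mult_left_mono[OF _ C0])
    have "1 + real n ^ n / fact n \<le> 1 + 3 ^ n"
      using power_self_le_fact[of n] by (simp add: divide_le_eq)
    also have "\<dots> \<le> (4::real) ^ n"
    proof -
      have "(3::real) ^ (n - 1) \<le> 4 ^ (n - 1)" "(1::real) \<le> 4 ^ (n - 1)"
        by (auto intro: power_mono)
      then have "1 + 3 * 3 ^ (n - 1) \<le> 4 * (4::real) ^ (n - 1)" by linarith
      then show ?thesis using n0 by (simp flip: power_Suc)
    qed
    finally show "1 + real n ^ n / fact n \<le> 4 ^ n" .
  qed
  finally have "norm (D l 0) * d ^ l \<le> fact l * (C * 288 ^ n)"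
    by (simp add: mult_left_mono mult_ac flip: power_mult_distrib)
  also have "\<dots> \<le> real n ^ l * (C * 288 ^ n)"
  proof (rule mult_right_mono)
    have "fact l \<le> real l ^ l" using fact_le_power[of l, where 'a=real] by simp
    also have "\<dots> \<le> real n ^ l" using l by (intro power_mono) auto
    finally show "fact l \<le> real n ^ l" .
  qed (use C0 in simp)
  finally have "norm (D l 0) * (real n ^ l / r ^ l) \<le> real n ^ l * (C * 288 ^ n)"
    by (simp add: d_def power_divide)
  then have "norm (D l 0) \<le> C * 288 ^ n * r ^ l"
    using n0 r by (simp add: field_simps)
  then show ?thesis by (simp add: nD)
qed

text \<open>
  For a continuous function the set where the bound holds is closed, and a closed set that
  contains almost every point of an open interval contains its closure.
\<close>

lemma Linf_norm_le_iff:
  fixes g :: "real \<Rightarrow> 'a::real_normed_field"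
  assumes "a < b" and g: "continuous_on {a..b} g"
  shows "Linf_norm {a..b} g \<le> ereal c \<longleftrightarrow> (\<forall>x\<in>{a..b}. norm (g x) \<le> c)"
proof
  assume le: "Linf_norm {a..b} g \<le> ereal c"
  define K where "K = {x \<in> {a..b}. norm (g x) \<le> c}"
  have "closed K"
    unfolding K_def by (intro continuous_on_closed_Collect_le continuous_intros g)
  have "AE x in lebesgue_on {a..b}. ereal (norm (g x)) \<le> Linf_norm {a..b} g"
    unfolding Linf_norm_def by (rule esssup_AE)
  then have "AE x in lebesgue_on {a..b}. norm (g x) \<le> c"
    using le by (auto elim!: eventually_mono dest: order_trans)
  then have "AE x \<in> {a<..<b} in lebesgue. x \<in> K"
    by (subst (asm) AE_restrict_space_iff) (auto simp: K_def elim!: eventually_mono)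
  then have "{a<..<b} \<subseteq> K"
    using mem_closed_if_AE_lebesgue_open[OF open_greaterThanLessThan \<open>closed K\<close>] by (intro subsetI)
  then have "closure {a<..<b} \<subseteq> K"
    using \<open>closed K\<close> by (rule closure_minimal)
  then show "\<forall>x\<in>{a..b}. norm (g x) \<le> c"
    using \<open>a < b\<close> by (auto simp: K_def)
next
  assume bd: "\<forall>x\<in>{a..b}. norm (g x) \<le> c"
  have "(\<lambda>x. norm (g x)) \<in> borel_measurable (lebesgue_on {a..b})"
    using g by (intro continuous_imp_measurable_on_sets_lebesgue continuous_intros) auto
  then have "(\<lambda>x. ereal (norm (g x))) \<in> borel_measurable (lebesgue_on {a..b})"
    by measurable
  then show "Linf_norm {a..b} g \<le> ereal c"
    unfolding Linf_norm_def using bd by (intro esssup_I AE_I2) (auto simp: space_restrict_space)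
qed

section \<open>Weight sequences and base sequences\<close>

lemma weight_root_pos:
  assumes "weight_sequence M"
  shows "weight_root M k > 0"
  using assms by (simp add: weight_root_def weight_sequence_def)

lemma weight_root_power:
  assumes "weight_sequence M"
  shows "weight_root M k ^ k = M k"
  using assms by (simp add: weight_root_def weight_sequence_def less_imp_le)

lemma weight_le_quotient_power:
  assumes M: "weight_sequence M" and "k \<ge> 1"
  shows "M k \<le> weight_quotient M (Suc k) ^ k"
  using \<open>k \<ge> 1\<close>
proof (induction k rule: dec_induct)
  case base
  then show ?case using M by (simp add: weight_sequence_def numeral_2_eq_2)
next
  case (step k)
  have pos: "M i > 0" for i using M by (simp add: weight_sequence_def)
  have q: "weight_quotient M (Suc k) \<le> weight_quotient M (Suc (Suc k))"
    using M step by (simp add: weight_sequence_def)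
  have q0: "weight_quotient M (Suc k) > 0" using pos by (simp add: weight_quotient_def)
  have "M (Suc k) = weight_quotient M (Suc k) * M k"
    using pos[of k] by (simp add: weight_quotient_def)
  also have "\<dots> \<le> weight_quotient M (Suc k) * weight_quotient M (Suc k) ^ k"
    using step q0 by simp
  also have "\<dots> \<le> weight_quotient M (Suc (Suc k)) ^ Suc k"
    using power_mono[OF q, of "Suc k"] q0 by simp
  finally show ?case .
qed

text \<open>
  As \<open>M k\<close> is the product of the first \<open>k\<close> quotients and these increase, the geometric mean
  \<open>m\<^sub>k\<close> of the quotients is at most the next quotient, so including it raises the mean.
\<close>

lemma weight_root_mono:
  assumes M: "weight_sequence M"
  shows "mono (weight_root M)"
proof (rule incseq_SucI)
  fix k
  have pos: "M i > 0" for i using M by (simp add: weight_sequence_def)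
  show "weight_root M k \<le> weight_root M (Suc k)"
  proof (cases "k = 0")
    case True
    then show ?thesis using M by (simp add: weight_root_def weight_sequence_def)
  next
    case False
    have "M k ^ Suc k \<le> weight_quotient M (Suc k) ^ k * M k ^ k"
      using weight_le_quotient_power[OF M, of k] False pos[of k] by simp
    also have "\<dots> = M (Suc k) ^ k"
      using pos[of k] by (simp add: weight_quotient_def flip: power_mult_distrib)
    finally have "(weight_root M k ^ k) ^ Suc k \<le> (weight_root M (Suc k) ^ Suc k) ^ k"
      by (simp only: weight_root_power[OF M])
    then have "weight_root M k ^ (k * Suc k) \<le> weight_root M (Suc k) ^ (k * Suc k)"
      by (simp only: power_mult[symmetric] mult.commute)
    then show ?thesis
      using False weight_root_pos[OF M] by (simp add: power_mono_iff less_imp_le)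
  qed
qed

lemma base_sequence_bracket:
  assumes "base_sequence k"
  shows "\<exists>j. k j \<le> l \<and> l < k (Suc j)"
proof (induction l)
  case 0
  have "k 0 = 0" "k 0 < k (Suc 0)"
    using assms strict_monoD[of k 0 "Suc 0"] by (auto simp: base_sequence_def)
  then show ?case by auto
next
  case (Suc l)
  then obtain j where j: "k j \<le> l" "l < k (Suc j)" by blast
  have "k (Suc j) < k (Suc (Suc j))" using assms by (simp add: base_sequence_def strict_mono_def)
  then show ?case using j by (metis Suc_leI le_SucI nat_less_le)
qed

section \<open>From a base sequence to all orders\<close>

lemma eventual_bound_imp_uniform:
  fixes F :: "nat \<Rightarrow> ereal"
  assumes fin: "\<And>l. \<exists>c. F l \<le> ereal c"
    and pos: "\<And>l. G l > 0"
    and ev: "eventually (\<lambda>l. F l \<le> ereal (C * G l)) sequentially"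
  shows "\<exists>C'>0. \<forall>l. F l \<le> ereal (C' * G l)"
proof -
  obtain N where N: "\<And>l. l \<ge> N \<Longrightarrow> F l \<le> ereal (C * G l)"
    using ev by (auto simp: eventually_sequentially)
  obtain c where c: "\<And>l. F l \<le> ereal (c l)" using fin by metis
  define C' where "C' = 1 + \<bar>C\<bar> + (\<Sum>l<N. \<bar>c l\<bar> / G l)"
  have s0: "(\<Sum>l<N. \<bar>c l\<bar> / G l) \<ge> 0"
    using pos by (intro sum_nonneg) (simp add: less_imp_le)
  have "F l \<le> ereal (C' * G l)" for l
  proof (cases "l < N")
    case True
    have "\<bar>c l\<bar> / G l \<le> (\<Sum>l<N. \<bar>c l\<bar> / G l)"
      using True pos by (intro member_le_sum) (auto simp: less_imp_le)
    then have "\<bar>c l\<bar> / G l \<le> C'" by (simp add: C'_def)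
    then have "c l \<le> C' * G l" using pos[of l] by (simp add: field_simps)
    then show ?thesis using c[of l] order_trans by (metis ereal_less_eq(3))
  next
    case False
    have "C \<le> C'" using s0 by (simp add: C'_def)
    then have "C * G l \<le> C' * G l" using pos[of l] by simp
    then show ?thesis using N[of l] False by (meson ereal_less_eq(3) not_less order_trans)
  qed
  moreover have "C' > 0" using s0 by (simp add: C'_def)
  ultimately show ?thesis by blast
qed

text \<open>
  The factor \<open>A\<close> is chosen before \<open>f\<close>, \<open>C\<close> and \<open>\<rho>\<close>. For the Beurling class this order of the
  quantifiers is essential: a prescribed \<open>\<sigma>\<close> is reached by starting from \<open>\<rho> = \<sigma> / A\<close>.
\<close>

lemma base_estimates_imp_all_estimates:
  fixes a b :: real
  assumes ab: "a < b" and k: "special_base_sequence k" and M: "weight_sequence M"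
    and ratio: "bounded (range (\<lambda>j. weight_root M (k (Suc j)) / weight_root M (k j)))"
  shows "\<exists>A>0. \<forall>f \<in> (C_infinity_on {a..b} :: (real \<Rightarrow> 'a::real_normed_field) set). \<forall>C. \<forall>\<rho>>0.
      (\<forall>l\<in>range k. Linf_norm {a..b} (nth_deriv_within {a..b} l f)
         \<le> ereal (C * (\<rho> * weight_root M l) ^ l)) \<longrightarrow>
      eventually (\<lambda>j. 2 * real j \<le> \<rho> * weight_root M j * (b - a)) sequentially \<longrightarrow>
      (\<exists>C'>0. \<forall>l. Linf_norm {a..b} (nth_deriv_within {a..b} l f)
             \<le> ereal (C' * (A * \<rho> * weight_root M l) ^ l))"
proof -
  let ?m = "weight_root M"
  have base: "base_sequence k" using k by (simp add: special_base_sequence_def)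
  have m0: "?m l > 0" for l by (rule weight_root_pos[OF M])
  obtain R where "R > 0" and R: "\<And>j. \<bar>?m (k (Suc j)) / ?m (k j)\<bar> \<le> R"
    using ratio by (auto simp: bounded_pos)
  have mR: "?m (k (Suc j)) \<le> R * ?m (k j)" for j
    using R[of j] m0[of "k j"] m0[of "k (Suc j)"] by (simp add: divide_le_eq)
  obtain B0 where B0: "\<And>j. j \<ge> 1 \<Longrightarrow> \<bar>real (k (Suc j)) / real (k j)\<bar> \<le> B0"
    using k by (auto simp: special_base_sequence_def bounded_iff)
  define B where "B = nat \<lceil>B0\<rceil>"
  have kB: "k (Suc j) \<le> B * k j" if "j \<ge> 1" for j
  proof -
    have "k j > 0" using base that unfolding base_sequence_def
      by (metis One_nat_def less_eq_Suc_le strict_mono_less)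
    then have "real (k (Suc j)) \<le> B0 * real (k j)" using B0[OF that] by (simp add: divide_le_eq)
    also have "\<dots> \<le> real B * real (k j)"
      unfolding B_def by (intro mult_right_mono) linarith+
    finally show ?thesis by (simp flip: of_nat_mult)
  qed
  define A where "A = 288 ^ B * R"
  show ?thesis
  proof (rule exI[of _ A], intro conjI ballI allI impI)
    show "A > 0" using \<open>R > 0\<close> by (simp add: A_def)
    fix f :: "real \<Rightarrow> 'a" and C \<rho> :: real
    assume f: "f \<in> C_infinity_on {a..b}" and \<rho>: "\<rho> > 0"
      and est: "\<forall>l\<in>range k. Linf_norm {a..b} (nth_deriv_within {a..b} l f)
         \<le> ereal (C * (\<rho> * ?m l) ^ l)"
      and ev: "eventually (\<lambda>j. 2 * real j \<le> \<rho> * ?m j * (b - a)) sequentially"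
    note Linf = Linf_norm_le_iff[OF ab nth_deriv_within_continuous_on[OF f]]
    have est': "norm (nth_deriv_within {a..b} (k j) f x) \<le> C * (\<rho> * ?m (k j)) ^ k j"
      if "x \<in> {a..b}" for j x
      using est that by (auto simp: Linf)
    have f0: "norm (f x) \<le> C" if "x \<in> {a..b}" for x
      using est'[OF that, of 0] base by (simp add: base_sequence_def)
    then have C0: "C \<ge> 0" using ab norm_ge_zero order_trans
      by (metis atLeastAtMost_iff less_imp_le order_refl)
    obtain N where N: "\<And>j. j \<ge> N \<Longrightarrow> 2 * real j \<le> \<rho> * ?m j * (b - a)"
      using ev by (auto simp: eventually_sequentially)
    show "\<exists>C'>0. \<forall>l. Linf_norm {a..b} (nth_deriv_within {a..b} l f)
             \<le> ereal (C' * (A * \<rho> * ?m l) ^ l)"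
    proof (rule eventual_bound_imp_uniform[of _ _ C])
      fix l
      show "\<exists>c. Linf_norm {a..b} (nth_deriv_within {a..b} l f) \<le> ereal c"
      proof -
        have "bounded (nth_deriv_within {a..b} l f ` {a..b})"
          by (intro compact_imp_bounded compact_continuous_image nth_deriv_within_continuous_on f) auto
        then show ?thesis unfolding Linf bounded_iff by blast
      qed
      show "(A * \<rho> * ?m l) ^ l > 0" using \<open>A > 0\<close> \<rho> m0 by simp
    next
      \<comment> \<open>\<open>l \<ge> k 1\<close> ensures \<open>j \<ge> 1\<close> below: the ratio bound of a special base sequence says
        nothing about \<open>k 1 / k 0\<close>.\<close>
      have "Linf_norm {a..b} (nth_deriv_within {a..b} l f) \<le> ereal (C * (A * \<rho> * ?m l) ^ l)"
        if l: "l \<ge> N" "l \<ge> k 1" for l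
      proof -
        obtain j where j: "k j \<le> l" "l < k (Suc j)" using base_sequence_bracket[OF base] by blast
        then have "j \<ge> 1" using l by (cases j) auto
        define n where "n = k (Suc j)"
        have nB: "n \<le> B * l"
          using kB[OF \<open>j \<ge> 1\<close>] j(1) unfolding n_def by (meson le_trans mult_le_mono2)
        have mn: "?m n \<le> R * ?m l"
        proof -
          have "?m (k j) \<le> ?m l" using weight_root_mono[OF M] j(1) by (simp add: monoD)
          then show ?thesis using mR[of j] \<open>R > 0\<close> unfolding n_def
            by (meson less_imp_le mult_left_mono order_trans)
        qed
        have "norm (nth_deriv_within {a..b} l f x) \<le> C * (A * \<rho> * ?m l) ^ l" if x: "x \<in> {a..b}" for x
        proof -
          have "norm (nth_deriv_within {a..b} l f x) \<le> C * 288 ^ n * (\<rho> * ?m n) ^ l"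
          proof (rule intermediate_derivative_bound[OF f _ _ _ f0 _ x])
            show "l < n" using j by (simp add: n_def)
            then show "2 * real n \<le> \<rho> * ?m n * (b - a)" using N[of n] l by simp
            show "\<rho> * ?m n > 0" using \<rho> m0 by simp
          qed (use est' in \<open>auto simp: n_def\<close>)
          also have "\<dots> \<le> C * (288 ^ B) ^ l * (\<rho> * (R * ?m l)) ^ l"
          proof -
            have "(288::real) ^ n \<le> (288 ^ B) ^ l"
              unfolding power_mult[symmetric] using nB by (intro power_increasing) auto
            moreover have "(\<rho> * ?m n) ^ l \<le> (\<rho> * (R * ?m l)) ^ l"
              using mn \<rho> m0[of n] by (intro power_mono mult_left_mono) auto
            ultimately show ?thesis
              using C0 \<rho> m0[of n] by (intro mult_mono) auto
          qed
          also have "\<dots> = C * (A * \<rho> * ?m l) ^ l"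
            by (simp add: A_def power_mult_distrib mult_ac)
          finally show ?thesis .
        qed
        then show ?thesis by (simp add: Linf)
      qed
      then show "eventually (\<lambda>l. Linf_norm {a..b} (nth_deriv_within {a..b} l f)
          \<le> ereal (C * (A * \<rho> * ?m l) ^ l)) sequentially"
        unfolding eventually_sequentially by (intro exI[of _ "max N (k 1)"]) simp
    qed
  qed
qed

theorem theorem6p1:
  fixes a b :: real and I :: "real set"
    and k :: "nat \<Rightarrow> nat" and M :: "nat \<Rightarrow> real"
  assumes "a < b" and "I = {a..b}"
    and "special_base_sequence k"
    and "weight_sequence M"
    and "bounded (range (\<lambda>j. weight_root M (k (Suc j)) / weight_root M (k j)))"
  shows "(bounded (range (\<lambda>j. real j / weight_root M j)) \<longrightarrow>
            (roumieu_class_base M k I :: (real \<Rightarrow> 'a::real_normed_field) set) = roumieu_class M I)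
       \<and> ((\<lambda>j. real j / weight_root M j) \<longlonglongrightarrow> 0 \<longrightarrow>
            (beurling_class_base M k I :: (real \<Rightarrow> 'a) set) = beurling_class M I)"
proof -
  let ?m = "weight_root M"
  have m0: "?m l > 0" for l by (rule weight_root_pos[OF assms(4)])
  obtain A where "A > 0" and A: "\<forall>f \<in> (C_infinity_on I :: (real \<Rightarrow> 'a) set). \<forall>C. \<forall>\<rho>>0.
      (\<forall>l\<in>range k. Linf_norm I (nth_deriv_within I l f) \<le> ereal (C * (\<rho> * ?m l) ^ l)) \<longrightarrow>
      eventually (\<lambda>j. 2 * real j \<le> \<rho> * ?m j * (b - a)) sequentially \<longrightarrow>
      (\<exists>C'>0. \<forall>l. Linf_norm I (nth_deriv_within I l f) \<le> ereal (C' * (A * \<rho> * ?m l) ^ l))"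
    using base_estimates_imp_all_estimates[OF assms(1,3,4,5), where 'a='a, folded assms(2)]
    by (elim exE conjE) (rule that)
  have "(roumieu_class_base M k I :: (real \<Rightarrow> 'a) set) \<subseteq> roumieu_class M I"
    if bdd: "bounded (range (\<lambda>j. real j / ?m j))"
  proof
    fix f :: "real \<Rightarrow> 'a" assume "f \<in> roumieu_class_base M k I"
    then obtain C \<rho> where f: "f \<in> C_infinity_on I" and "C > 0" "\<rho> > 0"
      and est: "\<And>l. l \<in> range k \<Longrightarrow>
        Linf_norm I (nth_deriv_within I l f) \<le> ereal (C * (\<rho> * ?m l) ^ l)"
      by (auto simp: roumieu_class_base_def)
    obtain Q where "Q > 0" and Q: "\<And>j. \<bar>real j / ?m j\<bar> \<le> Q"
      using bdd by (auto simp: bounded_pos)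
    \<comment> \<open>Enlarging \<open>\<rho>\<close> keeps the estimates and makes the length condition true for every order.\<close>
    define \<sigma> where "\<sigma> = max \<rho> (2 * Q / (b - a))"
    have "\<sigma> > 0" "\<rho> \<le> \<sigma>" using \<open>\<rho> > 0\<close> by (auto simp: \<sigma>_def)
    have "2 * real j \<le> \<sigma> * ?m j * (b - a)" for j
    proof -
      have "2 * real j \<le> 2 * Q * ?m j" using Q[of j] m0[of j] by (simp add: divide_le_eq)
      also have "2 * Q \<le> \<sigma> * (b - a)"
        using assms(1) by (simp add: \<sigma>_def flip: pos_divide_le_eq)
      then have "2 * Q * ?m j \<le> \<sigma> * (b - a) * ?m j"
        using m0[of j] by (intro mult_right_mono) auto
      finally show ?thesis by (simp add: mult_ac)
    qed
    moreover have "Linf_norm I (nth_deriv_within I l f) \<le> ereal (C * (\<sigma> * ?m l) ^ l)"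
      if "l \<in> range k" for l
    proof -
      have "C * (\<rho> * ?m l) ^ l \<le> C * (\<sigma> * ?m l) ^ l"
        using \<open>C > 0\<close> \<open>\<rho> > 0\<close> \<open>\<rho> \<le> \<sigma>\<close> m0[of l] by (intro mult_left_mono power_mono mult_right_mono) auto
      then show ?thesis using est[OF that] by (meson ereal_less_eq(3) order_trans)
    qed
    ultimately obtain C' where "C' > 0"
      "\<forall>l. Linf_norm I (nth_deriv_within I l f) \<le> ereal (C' * (A * \<sigma> * ?m l) ^ l)"
      using A[rule_format, OF f \<open>\<sigma> > 0\<close>, of C] by auto
    moreover have "A * \<sigma> > 0" using \<open>A > 0\<close> \<open>\<sigma> > 0\<close> by simp
    ultimately show "f \<in> roumieu_class M I" using f unfolding roumieu_class_def by blast
  qed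
  moreover have "(beurling_class_base M k I :: (real \<Rightarrow> 'a) set) \<subseteq> beurling_class M I"
    if lim: "(\<lambda>j. real j / ?m j) \<longlonglongrightarrow> 0"
  proof
    fix f :: "real \<Rightarrow> 'a" assume "f \<in> beurling_class_base M k I"
    then have f: "f \<in> C_infinity_on I"
      and est: "\<And>\<rho>. \<rho> > 0 \<Longrightarrow> \<exists>C>0. \<forall>l\<in>range k.
        Linf_norm I (nth_deriv_within I l f) \<le> ereal (C * (\<rho> * ?m l) ^ l)"
      by (auto simp: beurling_class_base_def)
    have "\<exists>C>0. \<forall>l. Linf_norm I (nth_deriv_within I l f) \<le> ereal (C * (\<sigma> * ?m l) ^ l)"
      if "\<sigma> > 0" for \<sigma>
    proof -
      define \<rho> where "\<rho> = \<sigma> / A"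
      have "\<rho> > 0" "\<sigma> = A * \<rho>" using that \<open>A > 0\<close> by (auto simp: \<rho>_def)
      have "\<rho> * (b - a) / 2 > 0" using \<open>\<rho> > 0\<close> assms(1) by simp
      with lim have "eventually (\<lambda>j. real j / ?m j < \<rho> * (b - a) / 2) sequentially"
        by (rule order_tendstoD(2))
      then have "eventually (\<lambda>j. 2 * real j \<le> \<rho> * ?m j * (b - a)) sequentially"
      proof eventually_elim
        case (elim j)
        then have "real j < \<rho> * (b - a) / 2 * ?m j"
          using m0[of j] by (simp only: pos_divide_less_eq)
        then show ?case by (simp add: algebra_simps)
      qed
      then show ?thesis
        using est[OF \<open>\<rho> > 0\<close>] A[rule_format, OF f \<open>\<rho> > 0\<close>] unfolding \<open>\<sigma> = A * \<rho>\<close> by blast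
    qed
    then show "f \<in> beurling_class M I" using f unfolding beurling_class_def by blast
  qed
  moreover have "(roumieu_class M I :: (real \<Rightarrow> 'a) set) \<subseteq> roumieu_class_base M k I"
    unfolding roumieu_class_def roumieu_class_base_def by blast
  moreover have "(beurling_class M I :: (real \<Rightarrow> 'a) set) \<subseteq> beurling_class_base M k I"
    unfolding beurling_class_def beurling_class_base_def by blast
  ultimately show ?thesis by blast
qed

end
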